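(* Let $Y$ be a real Banach space which embeds isometrically into $L_1$ and has a monotone Schauder basis. Let $X$ be a Banach space with an octahedral norm, and let $H$ be a linear subspace of $L(Y,X)$ (with the operator norm) containing all finite-rank operators from $Y$ to $X$. Then $H$ has an octahedral norm.
   Context: All Banach spaces are real. $L(Y,X)$ is the space of bounded linear operators from $Y$ to $X$. A Schauder basis is monotone if its basis projections $P_k$ (onto the span of the first $k$ basis vectors) satisfy $\Vert P_k\Vert\le 1$. A Banach space $Z$ has an octahedral norm if for every finite-dimensional subspace $F$ of $Z$ and every $\varepsilon>0$ there exists $x\in S_Z$ such that $\Vert f+\lambda x\Vert\ge(1-\varepsilon)(\Vert f\Vert+|\lambda|)$ for all $f\in F$, $\lambda\in\mathbb R$. *)

theory Defs
  imports "HOL-Analysis.Analysis"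
begin

definition finite_dimensional :: "'a::real_vector set \<Rightarrow> bool" where
  "finite_dimensional F \<longleftrightarrow> (\<exists>B. finite B \<and> F \<subseteq> span B)"

text \<open>Octahedral norm, relative to a linear subspace H of a normed space
  (H carries the restricted norm).  For H = UNIV this is the definition of the paper.\<close>
definition octahedral_on :: "'a::real_normed_vector set \<Rightarrow> bool" where
  "octahedral_on H \<longleftrightarrow>
     (\<forall>F. subspace F \<and> F \<subseteq> H \<and> finite_dimensional F \<longrightarrow>
        (\<forall>\<epsilon>>0. \<exists>x\<in>H. norm x = 1 \<and>
           (\<forall>f\<in>F. \<forall>c::real. norm (f + c *\<^sub>R x) \<ge> (1 - \<epsilon>) * (norm f + \<bar>c\<bar>))))"

abbreviation octahedral_norm :: "'a::real_normed_vector itself \<Rightarrow> bool" where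
  "octahedral_norm (_::'a itself) \<equiv> octahedral_on (UNIV :: 'a set)"

definition schauder_basis :: "(nat \<Rightarrow> 'a::real_normed_vector) \<Rightarrow> bool" where
  "schauder_basis e \<longleftrightarrow>
     (\<forall>y. \<exists>!a::nat \<Rightarrow> real. (\<lambda>n. \<Sum>i<n. a i *\<^sub>R e i) \<longlonglongrightarrow> y)"

definition basis_coeffs :: "(nat \<Rightarrow> 'a::real_normed_vector) \<Rightarrow> 'a \<Rightarrow> nat \<Rightarrow> real" where
  "basis_coeffs e y = (THE a. (\<lambda>n. \<Sum>i<n. a i *\<^sub>R e i) \<longlonglongrightarrow> y)"

definition basis_proj :: "(nat \<Rightarrow> 'a::real_normed_vector) \<Rightarrow> nat \<Rightarrow> 'a \<Rightarrow> 'a" where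
  "basis_proj e k y = (\<Sum>i<k. basis_coeffs e y i *\<^sub>R e i)"

definition monotone_schauder_basis :: "(nat \<Rightarrow> 'a::real_normed_vector) \<Rightarrow> bool" where
  "monotone_schauder_basis e \<longleftrightarrow>
     schauder_basis e \<and> (\<forall>k y. norm (basis_proj e k y) \<le> norm y)"

text \<open>Isometric embedding into an L_1(\<mu>) space: a linear map T into integrable
  functions with \<integral>|T y| d\<mu> = \<parallel>y\<parallel>.  (Since the map is linear, it is then an
  isometry into the quotient space L_1(\<mu>).)\<close>
definition embeds_isometrically_into_L1 :: "'a::real_normed_vector itself \<Rightarrow> bool" where
  "embeds_isometrically_into_L1 _ \<longleftrightarrow>
     (\<exists>(M::real measure) (T::'a \<Rightarrow> real \<Rightarrow> real).
        (\<forall>a b x z t. T (a *\<^sub>R x + b *\<^sub>R z) t = a * T x t + b * T z t) \<and> (\<forall>y. integrable M (T y) \<and> (\<integral>t. \<bar>T y t\<bar> \<partial>M) = norm y))"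

definition finite_rank :: "('a::real_normed_vector \<Rightarrow>\<^sub>L 'b::real_normed_vector) \<Rightarrow> bool" where
  "finite_rank T \<longleftrightarrow> finite_dimensional (range (blinfun_apply T))"

end

theory Submission
  imports Defs
begin

text \<open>Given a finite-dimensional space F of operators, compactness of its unit sphere yields a
  single N such that the range E of the basis projection P N almost norms every member of F.
  Being a finite-dimensional subspace of an L_1 space, E is almost isometric to a subspace of some
  finite-dimensional ell_1. Iterating octahedrality of X produces unit vectors x_j that span an
  almost isometric copy of this ell_1 and are almost ell_1-orthogonal to the span of the f(y) with
  f in F and y in E. Composing P N with these maps gives a finite-rank T whose normalisation is the
  required direction: f + c T is tested at a point of E where f almost attains its norm.\<close>

section \<open>Compactness of balls in finite-dimensional subspaces\<close>

text \<open>Induction on the spanning set: a new vector \<open>b\<close> outside the closed space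
  \<open>span B\<close> has positive distance from it, and this bounds the coefficient of
  \<open>b\<close> on the ball. The radius is left arbitrary because the step uses the hypothesis
  for a larger ball.\<close>

lemma compact_cball_Int_span:
  fixes B :: "'a::real_normed_vector set"
  assumes "finite B"
  shows "compact (cball 0 r \<inter> span B)"
  using assms
proof (induction B arbitrary: r)
  case empty
  then show ?case by (simp add: finite_imp_compact)
next
  case (insert b B)
  show ?case
  proof (cases "b \<in> span B")
    case True
    then show ?thesis using insert.IH by (simp add: span_redundant)
  next
    case False
    \<comment> \<open>A convergent sequence is bounded, so it stays in one ball of
      \<open>span B\<close>, compact by induction.\<close>
    have "closed (span B)"
      unfolding closed_sequential_limits
    proof (intro allI impI, elim conjE)
      fix x l assume x: "\<forall>n. x n \<in> span B" "x \<longlonglongrightarrow> l"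
      obtain q where q: "\<And>n. norm (x n) \<le> q"
        using convergent_imp_bounded[OF x(2)] by (auto simp: bounded_iff)
      have "closed (cball 0 q \<inter> span B)"
        using insert.IH by (rule compact_imp_closed)
      then show "l \<in> span B"
        using x q closed_sequentially[of "cball 0 q \<inter> span B" x l] by auto
    qed
    then have d: "infdist b (span B) > 0" (is "?d > 0")
      using False by (intro infdist_pos_not_in_closed) (auto intro: span_zero)
    have coef: "\<bar>c\<bar> * ?d \<le> norm (s + c *\<^sub>R b)" if s: "s \<in> span B" for c s
    proof (cases "c = 0")
      case False
      have "?d \<le> dist b ((- (1/c)) *\<^sub>R s)"
        by (intro infdist_le span_scale s)
      then have "\<bar>c\<bar> * ?d \<le> \<bar>c\<bar> * norm (b + (1/c) *\<^sub>R s)"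
        by (intro mult_left_mono) (auto simp: dist_norm)
      also have "\<dots> = norm (c *\<^sub>R (b + (1/c) *\<^sub>R s))"
        by simp
      also have "\<dots> = norm (s + c *\<^sub>R b)"
        using False by (simp add: algebra_simps)
      finally show ?thesis .
    qed simp
    \<comment> \<open>By \<open>coef\<close>, \<open>R\<close> bounds the coefficient of
      \<open>b\<close> for vectors of norm at most \<open>r\<close>; the triangle inequality then
      bounds the remaining part in \<open>span B\<close> by \<open>r + R * norm b\<close>.\<close>
    define R where "R = r / ?d"
    define K where "K = (\<lambda>(c, s). s + c *\<^sub>R b) `
      ({-R..R} \<times> (cball 0 (r + R * norm b) \<inter> span B))"
    have "compact K"
      unfolding K_def
      by (intro compact_continuous_image compact_Times insert.IH compact_Icc)
        (auto simp: case_prod_unfold intro!: continuous_intros)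
    moreover have "cball 0 r \<inter> span (insert b B) = K \<inter> cball 0 r"
    proof (intro equalityI subsetI)
      fix x assume x: "x \<in> cball 0 r \<inter> span (insert b B)"
      then obtain c where c: "x - c *\<^sub>R b \<in> span B"
        by (auto simp: span_insert)
      have "\<bar>c\<bar> * ?d \<le> r"
        using coef[OF c, of c] x by simp
      then have cR: "\<bar>c\<bar> \<le> R"
        using d by (simp add: R_def field_simps)
      have "norm (x - c *\<^sub>R b) \<le> norm x + \<bar>c\<bar> * norm b"
        using norm_triangle_ineq4[of x "c *\<^sub>R b"] by simp
      also have "\<dots> \<le> r + R * norm b"
        using x cR by (intro add_mono mult_right_mono) auto
      finally have "(c, x - c *\<^sub>R b) \<in> {-R..R} \<times> (cball 0 (r + R * norm b) \<inter> span B)"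
        using c cR by auto
      then have "x \<in> K"
        unfolding K_def by (rule rev_image_eqI) simp
      then show "x \<in> K \<inter> cball 0 r" using x by simp
    next
      fix x assume x: "x \<in> K \<inter> cball 0 r"
      then obtain c s where s: "s \<in> span B" "x = s + c *\<^sub>R b"
        by (auto simp: K_def)
      have "s \<in> span (insert b B)"
        using s(1) span_mono[of B "insert b B"] by auto
      then show "x \<in> cball 0 r \<inter> span (insert b B)"
        using x s(2) by (auto intro!: span_add span_scale intro: span_base)
    qed
    ultimately show ?thesis
      by (simp add: compact_Int_closed)
  qed
qed

section \<open>Copies of finite-dimensional ell_1 in an octahedral space\<close>

text \<open>Each new vector is chosen octahedral to the span of \<open>B\<close> and all earlier
  vectors. Half of the tolerance goes to the induction hypothesis and half to the new
  vector.\<close>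

lemma octahedral_ell1_family:
  assumes oct: "octahedral_on (UNIV :: 'a::real_normed_vector set)"
    and "finite J" "finite B" "0 < \<delta>" "\<delta> < 1"
  shows "\<exists>x. (\<forall>j\<in>J. norm (x j :: 'a) = 1) \<and>
    (\<forall>g\<in>span B. \<forall>c. norm (g + (\<Sum>j\<in>J. c j *\<^sub>R x j)) \<ge> (1 - \<delta>) * (norm g + (\<Sum>j\<in>J. \<bar>c j\<bar>)))"
  using assms(2-5)
proof (induction J arbitrary: \<delta>)
  case empty
  then show ?case by (auto simp: algebra_simps)
next
  case (insert k J)
  obtain x where x1: "\<forall>j\<in>J. norm (x j) = 1"
    and x2: "\<And>g c. g \<in> span B \<Longrightarrow>
      norm (g + (\<Sum>j\<in>J. c j *\<^sub>R x j)) \<ge> (1 - \<delta>/2) * (norm g + (\<Sum>j\<in>J. \<bar>c j\<bar>))"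
    using insert.IH[of "\<delta>/2"] insert.prems by auto
  define G where "G = span (B \<union> x ` J)"
  have "finite_dimensional G"
    unfolding G_def finite_dimensional_def using insert.hyps insert.prems
    by (intro exI[of _ "B \<union> x ` J"]) simp
  then obtain u where u1: "norm u = 1"
    and u2: "\<And>g c. g \<in> G \<Longrightarrow> norm (g + c *\<^sub>R u) \<ge> (1 - \<delta>/2) * (norm g + \<bar>c\<bar>)"
    using oct[unfolded octahedral_on_def, rule_format, of G "\<delta>/2"] insert.prems
    by (auto simp: G_def)
  define x' where "x' = x(k := u)"
  have "norm (g + (\<Sum>j\<in>insert k J. c j *\<^sub>R x' j))
      \<ge> (1 - \<delta>) * (norm g + (\<Sum>j\<in>insert k J. \<bar>c j\<bar>))" if g: "g \<in> span B" for g c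
  proof -
    define s where "s = norm g + (\<Sum>j\<in>J. \<bar>c j\<bar>)"
    have s0: "s \<ge> 0" by (auto simp: s_def intro!: add_nonneg_nonneg sum_nonneg)
    have sum': "(\<Sum>j\<in>J. c j *\<^sub>R x' j) = (\<Sum>j\<in>J. c j *\<^sub>R x j)"
      using insert.hyps by (intro sum.cong) (auto simp: x'_def)
    have gG: "g + (\<Sum>j\<in>J. c j *\<^sub>R x j) \<in> G"
      unfolding G_def
    proof (intro span_add span_sum span_scale)
      show "g \<in> span (B \<union> x ` J)" using g span_mono[of B "B \<union> x ` J"] by auto
    qed (auto intro: span_base)
    \<comment> \<open>The two losses compound to at most \<delta>, since (1 - \<delta>/2)^2 = 1 -
      \<delta> + \<delta>^2/4.\<close>
    have "(1 - \<delta>) * (s + \<bar>c k\<bar>) \<le> (1 - \<delta>/2) * ((1 - \<delta>/2) * (s + \<bar>c k\<bar>))"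
    proof -
      have "1 - \<delta> \<le> (1 - \<delta>/2) * (1 - \<delta>/2)"
        by (simp add: algebra_simps)
      then show ?thesis
        using s0 mult_right_mono[of "1 - \<delta>" "(1 - \<delta>/2) * (1 - \<delta>/2)" "s + \<bar>c k\<bar>"] by (simp add: mult.assoc)
    qed
    also have "\<dots> \<le> (1 - \<delta>/2) * (norm (g + (\<Sum>j\<in>J. c j *\<^sub>R x j)) + \<bar>c k\<bar>)"
    proof (intro mult_left_mono)
      have "(1 - \<delta>/2) * \<bar>c k\<bar> \<le> 1 * \<bar>c k\<bar>"
        using insert.prems by (intro mult_right_mono) auto
      then show "(1 - \<delta>/2) * (s + \<bar>c k\<bar>) \<le> norm (g + (\<Sum>j\<in>J. c j *\<^sub>R x j)) + \<bar>c k\<bar>"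
        using x2[OF g, of c] unfolding s_def distrib_left by linarith
    qed (use insert.prems in auto)
    also have "\<dots> \<le> norm (g + (\<Sum>j\<in>J. c j *\<^sub>R x j) + c k *\<^sub>R u)"
      by (rule u2[OF gG])
    finally show ?thesis
      using insert.hyps sum' by (simp add: s_def x'_def algebra_simps)
  qed
  moreover have "\<forall>j\<in>insert k J. norm (x' j) = 1"
    using x1 u1 by (auto simp: x'_def)
  ultimately show ?case by blast
qed

section \<open>Finite families in L_1 and their ell_1 approximations\<close>

text \<open>Approximating simple functions are part of the definition of the Bochner integral; they
  are extracted from it, and the nonnegative integral of the error is turned into a real
  one.\<close>

lemma integrable_simple_approx:
  fixes f :: "'a \<Rightarrow> real"
  assumes f: "integrable M f" and "\<eta> > 0"
  shows "\<exists>s. Bochner_Integration.simple_bochner_integrable M s \<and> (\<integral>t. \<bar>f t - s t\<bar> \<partial>M) \<le> \<eta>"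
proof -
  obtain s where s: "\<And>i. Bochner_Integration.simple_bochner_integrable M (s i)"
    "(\<lambda>i. \<integral>\<^sup>+ t. norm (f t - s i t) \<partial>M) \<longlonglongrightarrow> 0"
    using f by (elim integrable.cases has_bochner_integral.cases) blast
  have "eventually (\<lambda>i. (\<integral>\<^sup>+ t. norm (f t - s i t) \<partial>M) < ennreal \<eta>) sequentially"
    using s(2) \<open>\<eta> > 0\<close> by (intro order_tendstoD(2)[of _ 0]) auto
  then obtain i where i: "(\<integral>\<^sup>+ t. norm (f t - s i t) \<partial>M) < ennreal \<eta>"
    by (auto simp: eventually_sequentially)
  have "integrable M (\<lambda>t. norm (f t - s i t))"
    using f integrableI_simple_bochner_integrable[OF s(1)[of i]] by simp
  then have "ennreal (\<integral>t. norm (f t - s i t) \<partial>M) < ennreal \<eta>"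
    using i by (subst (asm) nn_integral_eq_integral) auto
  then show ?thesis
    using s(1)[of i] \<open>\<eta> > 0\<close> by (intro exI[of _ "s i"]) (simp add: ennreal_less_iff)
qed

text \<open>The space splits into cells \<open>A v\<close> on which every \<open>s i\<close> is
  constant with value \<open>v i\<close>. The indices in \<open>J\<close> are these value tuples
  themselves, and \<open>d v i\<close> is \<open>v i\<close> weighted by the measure of the
  cell.\<close>

lemma integral_abs_simple_combination:
  fixes s :: "'i \<Rightarrow> 'a \<Rightarrow> real"
  assumes "finite I" and s: "\<And>i. i \<in> I \<Longrightarrow> Bochner_Integration.simple_bochner_integrable M (s i)"
  shows "\<exists>(J :: ('i \<Rightarrow> real) set) d. finite J \<and>
    (\<forall>a. (\<integral>t. \<bar>\<Sum>i\<in>I. a i * s i t\<bar> \<partial>M) = (\<Sum>j\<in>J. \<bar>\<Sum>i\<in>I. a i * d j i\<bar>))"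
proof -
  have sf: "simple_function M (s i)" and fin: "emeasure M {t\<in>space M. s i t \<noteq> 0} < \<infinity>" if "i \<in> I" for i
    using s[OF that] by (auto elim: simple_bochner_integrable.cases simp: less_top)
  define J where "J = PiE I (\<lambda>i. s i ` space M)"
  have J: "finite J"
    unfolding J_def using \<open>finite I\<close> sf by (intro finite_PiE) (auto simp: simple_function_def)
  define A where "A v = {t\<in>space M. \<forall>i\<in>I. s i t = v i}" for v
  have A[measurable]: "A v \<in> sets M" for v
  proof -
    have "{t\<in>space M. s i t = v i} \<in> sets M" if "i \<in> I" for i
      using borel_measurable_simple_function[OF sf[OF that]] by measurable
    then show ?thesis
      unfolding A_def using \<open>finite I\<close> by (rule sets.sets_Collect_finite_All)
  qed
  have "(\<integral>t. \<bar>\<Sum>i\<in>I. a i * s i t\<bar> \<partial>M) = (\<Sum>v\<in>J. \<bar>\<Sum>i\<in>I. a i * (measure M (A v) * v i)\<bar>)" for a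
  proof -
    have "(\<integral>t. \<bar>\<Sum>i\<in>I. a i * s i t\<bar> \<partial>M)
      = (\<integral>t. (\<Sum>v\<in>J. \<bar>\<Sum>i\<in>I. a i * v i\<bar> * indicator (A v) t) \<partial>M)"
    proof (rule Bochner_Integration.integral_cong[OF refl])
      fix t assume t: "t \<in> space M"
      \<comment> \<open>Exactly one cell contains \<open>t\<close>, that of its own tuple
        \<open>w\<close>; restricting to \<open>I\<close> makes tuples in \<open>J\<close> equal as
        soon as they agree on \<open>I\<close>.\<close>
      define w where "w = restrict (\<lambda>i. s i t) I"
      have w: "w \<in> J" using t by (auto simp: w_def J_def)
      have "indicator (A v) t = (if v = w then 1 else (0::real))" if "v \<in> J" for v
        using that t by (auto simp: A_def w_def J_def indicator_def PiE_iff intro!: extensionalityI)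
      then have "(\<Sum>v\<in>J. \<bar>\<Sum>i\<in>I. a i * v i\<bar> * indicator (A v) t)
          = (\<Sum>v\<in>J. if v = w then \<bar>\<Sum>i\<in>I. a i * v i\<bar> else 0)"
        by (intro sum.cong) auto
      also have "\<dots> = \<bar>\<Sum>i\<in>I. a i * w i\<bar>"
        using J w by simp
      finally show "\<bar>\<Sum>i\<in>I. a i * s i t\<bar> = (\<Sum>v\<in>J. \<bar>\<Sum>i\<in>I. a i * v i\<bar> * indicator (A v) t)"
        by (simp add: w_def)
    qed
    also have "\<dots> = (\<Sum>v\<in>J. \<integral>t. \<bar>\<Sum>i\<in>I. a i * v i\<bar> * indicator (A v) t \<partial>M)"
    proof (rule Bochner_Integration.integral_sum)
      fix v assume "v \<in> J"
      show "integrable M (\<lambda>t. \<bar>\<Sum>i\<in>I. a i * v i\<bar> * indicator (A v) t)"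
      \<comment> \<open>The zero tuple may have a cell of infinite measure, but its summand
        vanishes. Any other cell lies in the support of some \<open>s i\<close>, which has finite
        measure.\<close>
      proof (cases "\<forall>i\<in>I. v i = 0")
        case False
        then obtain i where i: "i \<in> I" "v i \<noteq> 0" by auto
        have "emeasure M (A v) \<le> emeasure M {t\<in>space M. s i t \<noteq> 0}"
          using i borel_measurable_simple_function[OF sf[OF i(1)]]
          by (intro emeasure_mono) (auto simp: A_def)
        then have "emeasure M (A v) < \<infinity>"
          using fin[OF i(1)] by (rule le_less_trans)
        then show ?thesis by (intro integrable_mult_right integrable_real_indicator) auto
      qed simp
    qed
    also have "\<dots> = (\<Sum>v\<in>J. \<bar>\<Sum>i\<in>I. a i * (measure M (A v) * v i)\<bar>)"
    proof (rule sum.cong[OF refl])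
      fix v
      have "(\<integral>t. \<bar>\<Sum>i\<in>I. a i * v i\<bar> * indicator (A v) t \<partial>M) = \<bar>\<Sum>i\<in>I. a i * v i\<bar> * measure M (A v)"
        using sets.sets_into_space[OF A[of v]] by (simp add: Int_absorb2)
      also have "\<dots> = \<bar>measure M (A v) * (\<Sum>i\<in>I. a i * v i)\<bar>"
        by (simp add: abs_mult)
      finally show "(\<integral>t. \<bar>\<Sum>i\<in>I. a i * v i\<bar> * indicator (A v) t \<partial>M)
          = \<bar>\<Sum>i\<in>I. a i * (measure M (A v) * v i)\<bar>"
        by (simp add: sum_distrib_left ac_simps)
    qed
    finally show ?thesis .
  qed
  then show ?thesis using J
    by (intro exI[of _ J] exI[of _ "\<lambda>v i. measure M (A v) * v i"]) simp
qed

text \<open>Replacing each \<open>f i\<close> by a simple function within \<eta> changes the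
  integral for coefficients \<open>a\<close> by at most \<eta> times the sum of the |a_i|. The error
  is measured by coefficients because the \<open>f i\<close> may be linearly dependent.\<close>

lemma L1_span_almost_ell1:
  fixes f :: "'i \<Rightarrow> 'a \<Rightarrow> real"
  assumes "finite I" and f: "\<And>i. i \<in> I \<Longrightarrow> integrable M (f i)" and "\<eta> > 0"
  shows "\<exists>(J :: ('i \<Rightarrow> real) set) d. finite J \<and>
    (\<forall>a. \<bar>(\<integral>t. \<bar>\<Sum>i\<in>I. a i * f i t\<bar> \<partial>M) - (\<Sum>j\<in>J. \<bar>\<Sum>i\<in>I. a i * d j i\<bar>)\<bar> \<le> \<eta> * (\<Sum>i\<in>I. \<bar>a i\<bar>))"
proof -
  have "\<forall>i\<in>I. \<exists>s. Bochner_Integration.simple_bochner_integrable M s \<and> (\<integral>t. \<bar>f i t - s t\<bar> \<partial>M) \<le> \<eta>"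
    using integrable_simple_approx[OF f \<open>\<eta> > 0\<close>] by blast
  then obtain s where s: "\<And>i. i \<in> I \<Longrightarrow> Bochner_Integration.simple_bochner_integrable M (s i)"
    and approx: "\<And>i. i \<in> I \<Longrightarrow> (\<integral>t. \<bar>f i t - s i t\<bar> \<partial>M) \<le> \<eta>"
    by metis
  obtain J :: "('i \<Rightarrow> real) set" and d where J: "finite J"
    and d: "\<And>a. (\<integral>t. \<bar>\<Sum>i\<in>I. a i * s i t\<bar> \<partial>M) = (\<Sum>j\<in>J. \<bar>\<Sum>i\<in>I. a i * d j i\<bar>)"
    using integral_abs_simple_combination[where I = I and M = M and s = s, OF \<open>finite I\<close>] s by auto
  note si = integrableI_simple_bochner_integrable[OF s]
  have "\<bar>(\<integral>t. \<bar>\<Sum>i\<in>I. a i * f i t\<bar> \<partial>M) - (\<Sum>j\<in>J. \<bar>\<Sum>i\<in>I. a i * d j i\<bar>)\<bar> \<le> \<eta> * (\<Sum>i\<in>I. \<bar>a i\<bar>)" for a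
  proof -
    have int: "integrable M (\<lambda>t. \<bar>\<Sum>i\<in>I. a i * f i t\<bar>)" "integrable M (\<lambda>t. \<bar>\<Sum>i\<in>I. a i * s i t\<bar>)"
      using f si by auto
    have "\<bar>(\<integral>t. \<bar>\<Sum>i\<in>I. a i * f i t\<bar> \<partial>M) - (\<Sum>j\<in>J. \<bar>\<Sum>i\<in>I. a i * d j i\<bar>)\<bar>
      = \<bar>\<integral>t. \<bar>\<Sum>i\<in>I. a i * f i t\<bar> - \<bar>\<Sum>i\<in>I. a i * s i t\<bar> \<partial>M\<bar>"
      using int by (simp add: d)
    also have "\<dots> \<le> (\<integral>t. \<bar>\<bar>\<Sum>i\<in>I. a i * f i t\<bar> - \<bar>\<Sum>i\<in>I. a i * s i t\<bar>\<bar> \<partial>M)"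
      by (rule integral_abs_bound)
    also have "\<dots> \<le> (\<integral>t. (\<Sum>i\<in>I. \<bar>a i\<bar> * \<bar>f i t - s i t\<bar>) \<partial>M)"
    proof (rule integral_mono)
      fix t
      have "\<bar>\<bar>\<Sum>i\<in>I. a i * f i t\<bar> - \<bar>\<Sum>i\<in>I. a i * s i t\<bar>\<bar> \<le> \<bar>\<Sum>i\<in>I. a i * (f i t - s i t)\<bar>"
        unfolding right_diff_distrib sum_subtractf by (rule abs_triangle_ineq3)
      also have "\<dots> \<le> (\<Sum>i\<in>I. \<bar>a i * (f i t - s i t)\<bar>)"
        by (rule sum_abs)
      finally show "\<bar>\<bar>\<Sum>i\<in>I. a i * f i t\<bar> - \<bar>\<Sum>i\<in>I. a i * s i t\<bar>\<bar> \<le> (\<Sum>i\<in>I. \<bar>a i\<bar> * \<bar>f i t - s i t\<bar>)"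
        by (simp add: abs_mult)
    qed (use int f si in auto)
    also have "\<dots> = (\<Sum>i\<in>I. \<bar>a i\<bar> * (\<integral>t. \<bar>f i t - s i t\<bar> \<partial>M))"
      using f si by (subst Bochner_Integration.integral_sum) auto
    also have "\<dots> \<le> (\<Sum>i\<in>I. \<bar>a i\<bar> * \<eta>)"
      using approx by (intro sum_mono mult_left_mono) auto
    finally show ?thesis
      by (simp add: sum_distrib_left mult.commute)
  qed
  then show ?thesis using J
    by (intro exI[of _ J] exI[of _ d]) simp
qed

section \<open>Coefficient functionals and projections of a Schauder basis\<close>

lemma basis_coeffs_tendsto:
  assumes "schauder_basis e"
  shows "(\<lambda>n. \<Sum>i<n. basis_coeffs e y i *\<^sub>R e i) \<longlonglongrightarrow> y"
  using assms theI'[of "\<lambda>a. (\<lambda>n. \<Sum>i<n. a i *\<^sub>R e i) \<longlonglongrightarrow> y"]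
  unfolding schauder_basis_def basis_coeffs_def by blast

lemma basis_coeffs_eqI:
  assumes "schauder_basis e" "(\<lambda>n. \<Sum>i<n. a i *\<^sub>R e i) \<longlonglongrightarrow> y"
  shows "basis_coeffs e y = a"
  using assms basis_coeffs_tendsto[OF assms(1), of y] unfolding schauder_basis_def by blast

lemma basis_proj_tendsto:
  assumes "schauder_basis e"
  shows "(\<lambda>n. basis_proj e n y) \<longlonglongrightarrow> y"
  using basis_coeffs_tendsto[OF assms] unfolding basis_proj_def .

lemma basis_coeffs_add:
  assumes "schauder_basis e"
  shows "basis_coeffs e (x + y) i = basis_coeffs e x i + basis_coeffs e y i"
proof -
  have "basis_coeffs e (x + y) = (\<lambda>i. basis_coeffs e x i + basis_coeffs e y i)"
    using tendsto_add[OF basis_coeffs_tendsto[OF assms, of x] basis_coeffs_tendsto[OF assms, of y]]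
    by (intro basis_coeffs_eqI[OF assms]) (simp add: scaleR_add_left sum.distrib)
  then show ?thesis by simp
qed

lemma basis_coeffs_scaleR:
  assumes "schauder_basis e"
  shows "basis_coeffs e (c *\<^sub>R y) i = c * basis_coeffs e y i"
proof -
  have "basis_coeffs e (c *\<^sub>R y) = (\<lambda>i. c * basis_coeffs e y i)"
    using tendsto_scaleR[OF tendsto_const basis_coeffs_tendsto[OF assms, of y], of c]
    by (intro basis_coeffs_eqI[OF assms]) (simp add: scaleR_sum_right)
  then show ?thesis by simp
qed

lemma basis_coeffs_basis_proj:
  assumes "schauder_basis e"
  shows "basis_coeffs e (basis_proj e k y) i = (if i < k then basis_coeffs e y i else 0)"
proof -
  have "(\<Sum>i<n. (if i < k then basis_coeffs e y i else 0) *\<^sub>R e i) = basis_proj e k y" if "n \<ge> k" for n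
    unfolding basis_proj_def using that by (intro sum.mono_neutral_cong_right) auto
  then have "(\<lambda>n. \<Sum>i<n. (if i < k then basis_coeffs e y i else 0) *\<^sub>R e i) \<longlonglongrightarrow> basis_proj e k y"
    by (intro tendsto_eventually) (auto simp: eventually_sequentially)
  then show ?thesis
    by (simp add: basis_coeffs_eqI[OF assms])
qed

lemma basis_proj_basis_proj:
  assumes "schauder_basis e" "k \<le> m"
  shows "basis_proj e m (basis_proj e k y) = basis_proj e k y"
proof -
  have "basis_proj e m (basis_proj e k y) = (\<Sum>i<m. (if i < k then basis_coeffs e y i else 0) *\<^sub>R e i)"
    unfolding basis_proj_def[of e m] by (simp add: basis_coeffs_basis_proj[OF assms(1)])
  also have "\<dots> = basis_proj e k y"
    unfolding basis_proj_def using assms(2) by (intro sum.mono_neutral_cong_right) auto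
  finally show ?thesis .
qed

lemma basis_proj_scaleR:
  assumes "schauder_basis e"
  shows "basis_proj e k (c *\<^sub>R y) = c *\<^sub>R basis_proj e k y"
  by (simp add: basis_proj_def basis_coeffs_scaleR[OF assms] scaleR_sum_right)

lemma basis_coeffs_basis:
  assumes "schauder_basis e"
  shows "basis_coeffs e (e k) = (\<lambda>i. if i = k then 1 else 0)"
proof (rule basis_coeffs_eqI[OF assms], rule tendsto_eventually)
  have "(\<Sum>i<n. (if i = k then 1 else 0) *\<^sub>R e i) = e k" if "n > k" for n
    using that by (simp add: if_distrib[of "\<lambda>c. c *\<^sub>R _"] cong: if_cong)
  then show "\<forall>\<^sub>F n in sequentially. (\<Sum>i<n. (if i = k then 1 else 0) *\<^sub>R e i) = e k"
    by (auto simp: eventually_sequentially intro!: exI[of _ "Suc k"])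
qed

lemma schauder_basis_nonzero:
  assumes "schauder_basis e"
  shows "e k \<noteq> 0"
proof
  assume "e k = 0"
  then have "basis_coeffs e (e k) k = 0"
    using basis_coeffs_scaleR[OF assms, of 0 "e k" k] by simp
  then show False by (simp add: basis_coeffs_basis[OF assms])
qed

text \<open>The i-th term of the expansion is a difference of two consecutive projections, each of
  norm at most \<open>norm y\<close>; hence the factor 2. The bound yields continuity of the
  coefficients and later turns coefficient errors into norm errors.\<close>

lemma abs_basis_coeffs_le:
  assumes "monotone_schauder_basis e"
  shows "\<bar>basis_coeffs e y i\<bar> \<le> norm y * (2 / norm (e i))"
proof -
  have sb: "schauder_basis e" and mono: "\<And>k. norm (basis_proj e k y) \<le> norm y"
    using assms by (auto simp: monotone_schauder_basis_def)
  have "\<bar>basis_coeffs e y i\<bar> * norm (e i) = norm (basis_proj e (Suc i) y - basis_proj e i y)"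
    by (simp add: basis_proj_def)
  also have "\<dots> \<le> norm y + norm y"
    using norm_triangle_ineq4 mono by (metis add_mono order_trans)
  finally show ?thesis
    using schauder_basis_nonzero[OF sb, of i] by (simp add: field_simps)
qed

lemma bounded_linear_basis_coeffs:
  assumes "monotone_schauder_basis e"
  shows "bounded_linear (\<lambda>y. basis_coeffs e y i)"
proof -
  have "schauder_basis e"
    using assms by (auto simp: monotone_schauder_basis_def)
  then show ?thesis
    using abs_basis_coeffs_le[OF assms, of _ i]
    by (intro bounded_linear_intro[where K = "2 / norm (e i)"])
      (auto simp: basis_coeffs_add basis_coeffs_scaleR)
qed

section \<open>Finite sections of a monotone basis\<close>

text \<open>A single operator is almost normed on the range of some projection, because the
  projections converge pointwise and keep the unit ball invariant. Compactness of the unit sphere of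
  \<open>span B\<close> makes the index uniform. Being fixed by \<open>basis_proj e N\<close>
  expresses membership in the range.\<close>

lemma basis_section_almost_norming:
  fixes B :: "('y::real_normed_vector \<Rightarrow>\<^sub>L 'x::real_normed_vector) set"
  assumes basis: "monotone_schauder_basis e" and "finite B" and "0 < \<delta>" "\<delta> < 1"
  shows "\<exists>N. \<forall>f\<in>span B. \<exists>z. norm z = 1 \<and> basis_proj e N z = z \<and> norm (blinfun_apply f z) \<ge> (1 - \<delta>) * norm f"
proof -
  have sb: "schauder_basis e" and mono: "\<And>k y. norm (basis_proj e k y) \<le> norm y"
    using basis by (auto simp: monotone_schauder_basis_def)
  define K where "K = sphere 0 1 \<inter> span B"
  \<comment> \<open>The open sets V n increase to a cover of K.\<close>
  define V where "V n = (\<Union>y\<in>{y. norm y \<le> 1 \<and> basis_proj e n y = y}. {f :: 'y \<Rightarrow>\<^sub>L 'x. norm (blinfun_apply f y) > 1 - \<delta>})" for n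
  have "compact K"
  proof -
    have "K = (cball 0 1 \<inter> span B) \<inter> sphere 0 1" by (auto simp: K_def)
    moreover have "closed (sphere 0 1 :: ('y \<Rightarrow>\<^sub>L 'x) set)"
      by (simp add: sphere_def closed_Collect_eq continuous_intros)
    ultimately show ?thesis
      using compact_Int_closed[OF compact_cball_Int_span[OF \<open>finite B\<close>]] by (simp only:)
  qed
  moreover have "open (V n)" for n
    unfolding V_def by (intro open_UN ballI open_Collect_less continuous_intros)
  moreover have "K \<subseteq> (\<Union>n\<in>UNIV. V n)"
  proof
    fix f assume "f \<in> K"
    then have f: "norm f = 1" by (simp add: K_def)
    have "\<exists>y. norm y \<le> 1 \<and> norm (blinfun_apply f y) > 1 - \<delta>"
    proof (rule ccontr)
      assume *: "\<nexists>y. norm y \<le> 1 \<and> norm (blinfun_apply f y) > 1 - \<delta>"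
      have "norm (blinfun_apply f y) \<le> (1 - \<delta>) * norm y" for y
      proof (cases "y = 0")
        case False
        then have "norm (blinfun_apply f ((1 / norm y) *\<^sub>R y)) \<le> 1 - \<delta>"
          using * by (auto simp: not_less)
        then show ?thesis
          using False by (simp add: blinfun.scaleR_right field_simps)
      qed simp
      then have "norm f \<le> 1 - \<delta>"
        using \<open>\<delta> < 1\<close> by (intro norm_blinfun_bound) auto
      then show False using f \<open>0 < \<delta>\<close> by simp
    qed
    then obtain y where y: "norm y \<le> 1" "norm (blinfun_apply f y) > 1 - \<delta>" by blast
    have "(\<lambda>n. norm (blinfun_apply f (basis_proj e n y))) \<longlonglongrightarrow> norm (blinfun_apply f y)"
      by (intro tendsto_intros basis_proj_tendsto sb)
    then have "\<forall>\<^sub>F n in sequentially. norm (blinfun_apply f (basis_proj e n y)) > 1 - \<delta>"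
      using y(2) by (rule order_tendstoD)
    then obtain n where "norm (blinfun_apply f (basis_proj e n y)) > 1 - \<delta>"
      by (auto simp: eventually_sequentially)
    moreover have "norm (basis_proj e n y) \<le> 1" using mono[of n y] y(1) by simp
    ultimately show "f \<in> (\<Union>n\<in>UNIV. V n)"
      using basis_proj_basis_proj[OF sb order_refl] by (force simp: V_def)
  qed
  ultimately obtain C where C: "finite C" "K \<subseteq> (\<Union>n\<in>C. V n)"
    by (rule compactE_image)
  \<comment> \<open>Inserting 0 gives \<open>Max\<close> a nonempty argument. The successor ensures
    that the range contains \<open>e 0\<close>, which supplies the unit vector demanded even for the
    zero operator.\<close>
  define N where "N = Suc (Max (insert 0 C))"
  have NC: "n \<le> N" if "n \<in> C" for n
    using that C(1) by (auto simp: N_def intro!: le_SucI Max_ge)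
  have N1: "N \<ge> 1" by (simp add: N_def)
  have "\<exists>z. norm z = 1 \<and> basis_proj e N z = z \<and> norm (blinfun_apply f z) \<ge> (1 - \<delta>) * norm f"
    if f: "f \<in> span B" for f
  proof (cases "f = 0")
    case True
    define z where "z = (1 / norm (e 0)) *\<^sub>R e 0"
    have "basis_proj e N (e 0) = e 0"
      using N1 by (simp add: basis_proj_def basis_coeffs_basis[OF sb] if_distrib[of "\<lambda>c. c *\<^sub>R _"] cong: if_cong)
    then have "basis_proj e N z = z" by (simp add: z_def basis_proj_scaleR[OF sb])
    then show ?thesis
      using True schauder_basis_nonzero[OF sb, of 0] by (intro exI[of _ z]) (simp add: z_def)
  next
    case False
    then have "(1 / norm f) *\<^sub>R f \<in> K" using f by (simp add: K_def span_scale)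
    then obtain n y where n: "n \<in> C" and y: "norm y \<le> 1" "basis_proj e n y = y"
      "norm (blinfun_apply ((1 / norm f) *\<^sub>R f) y) > 1 - \<delta>"
      using C(2) unfolding V_def by blast
    have "y \<noteq> 0" using y(3) \<open>\<delta> < 1\<close> by auto
    have fy: "norm (blinfun_apply f y) > (1 - \<delta>) * norm f"
      using y(3) False by (simp add: blinfun.scaleR_left field_simps)
    \<comment> \<open>Moving \<open>y\<close> from the ball to the sphere divides by a number at
      most 1, so the lower bound survives.\<close>
    have "(1 - \<delta>) * norm f * norm y \<le> (1 - \<delta>) * norm f * 1"
      using y(1) \<open>\<delta> < 1\<close> by (intro mult_left_mono) auto
    then have "(1 - \<delta>) * norm f \<le> norm (blinfun_apply f ((1 / norm y) *\<^sub>R y))"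
      using fy \<open>y \<noteq> 0\<close> by (simp add: blinfun.scaleR_right field_simps)
    moreover have "basis_proj e N y = y"
      using basis_proj_basis_proj[OF sb NC[OF n], of y] y(2) by simp
    ultimately show ?thesis
      using \<open>y \<noteq> 0\<close> by (intro exI[of _ "(1 / norm y) *\<^sub>R y"]) (simp add: basis_proj_scaleR[OF sb])
  qed
  then show ?thesis by blast
qed

text \<open>The image in L_1 of a vector of the section is a combination of the N functions
  \<open>T (e i)\<close>, and the coefficient bound makes the error relative to the norm. The row
  \<open>d j\<close> gives the j-th ell_1 coordinates of the basis vectors.\<close>

lemma basis_section_almost_ell1:
  fixes e :: "nat \<Rightarrow> 'y::real_normed_vector"
  assumes L1: "embeds_isometrically_into_L1 TYPE('y)"
    and basis: "monotone_schauder_basis e" and "0 < \<delta>"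
  shows "\<exists>(J :: (nat \<Rightarrow> real) set) d. finite J \<and>
    (\<forall>z. basis_proj e N z = z \<longrightarrow>
      \<bar>norm z - (\<Sum>j\<in>J. \<bar>\<Sum>i<N. basis_coeffs e z i * d j i\<bar>)\<bar> \<le> \<delta> * norm z)"
proof -
  obtain M :: "real measure" and T :: "'y \<Rightarrow> real \<Rightarrow> real"
    where lin: "\<And>a b x z t. T (a *\<^sub>R x + b *\<^sub>R z) t = a * T x t + b * T z t"
      and int: "\<And>y. integrable M (T y)" and iso: "\<And>y. (\<integral>t. \<bar>T y t\<bar> \<partial>M) = norm y"
    using L1 unfolding embeds_isometrically_into_L1_def by blast
  have T0: "T 0 t = 0" for t using lin[of 0 0 0 0 t] by simp
  have Tsum: "T (\<Sum>i<n. a i *\<^sub>R e i) t = (\<Sum>i<n. a i * T (e i) t)" for n a t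
  proof (induction n)
    case (Suc n)
    then show ?case using lin[of 1 "\<Sum>i<n. a i *\<^sub>R e i" "a n" "e n" t] by simp
  qed (simp add: T0)
  define S where "S = (\<Sum>i<N. 2 / norm (e i))"
  have S: "S \<ge> 0" unfolding S_def by (intro sum_nonneg) auto
  \<comment> \<open>Monotonicity of the basis gives sum of |a_i| <= S * norm z for the coefficients a_i of z.\<close>
  define \<eta> where "\<eta> = \<delta> / (1 + S)"
  have \<eta>: "\<eta> > 0" using \<open>0 < \<delta>\<close> S by (simp add: \<eta>_def)
  obtain J :: "(nat \<Rightarrow> real) set" and d where J: "finite J"
    and d: "\<And>a. \<bar>(\<integral>t. \<bar>\<Sum>i<N. a i * T (e i) t\<bar> \<partial>M) - (\<Sum>j\<in>J. \<bar>\<Sum>i<N. a i * d j i\<bar>)\<bar>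
        \<le> \<eta> * (\<Sum>i<N. \<bar>a i\<bar>)"
    using L1_span_almost_ell1[of "{..<N}" M "\<lambda>i. T (e i)", OF finite_lessThan int \<eta>] by blast
  have "\<bar>norm z - (\<Sum>j\<in>J. \<bar>\<Sum>i<N. basis_coeffs e z i * d j i\<bar>)\<bar> \<le> \<delta> * norm z"
    if z: "basis_proj e N z = z" for z
  proof -
    have "T z t = (\<Sum>i<N. basis_coeffs e z i * T (e i) t)" for t
      using Tsum[of "basis_coeffs e z" N t] z by (simp add: basis_proj_def)
    then have "norm z = (\<integral>t. \<bar>\<Sum>i<N. basis_coeffs e z i * T (e i) t\<bar> \<partial>M)"
      using iso[of z] by simp
    then have "\<bar>norm z - (\<Sum>j\<in>J. \<bar>\<Sum>i<N. basis_coeffs e z i * d j i\<bar>)\<bar>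
        \<le> \<eta> * (\<Sum>i<N. \<bar>basis_coeffs e z i\<bar>)"
      using d[of "basis_coeffs e z"] by simp
    also have "\<dots> \<le> \<eta> * (norm z * S)"
      using \<eta> abs_basis_coeffs_le[OF basis, of z] unfolding S_def sum_distrib_left
      by (intro mult_left_mono sum_mono) auto
    also have "\<dots> \<le> \<delta> * norm z"
    proof -
      have "\<eta> * S \<le> \<delta>" using S \<open>0 < \<delta>\<close> by (simp add: \<eta>_def field_simps)
      then show ?thesis using mult_right_mono[of "\<eta> * S" \<delta> "norm z"] by (simp add: ac_simps)
    qed
    finally show ?thesis .
  qed
  then show ?thesis using J by blast
qed

section \<open>The octahedral direction in the operator space\<close>

theorem mainTheorem6:
  fixes H :: "('y::banach \<Rightarrow>\<^sub>L 'x::banach) set"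
    and e :: "nat \<Rightarrow> 'y"
  assumes "embeds_isometrically_into_L1 TYPE('y)"
    and "monotone_schauder_basis e"
    and "octahedral_norm TYPE('x)"
    and "subspace H"
    and "\<And>T. finite_rank T \<Longrightarrow> T \<in> H"
  shows "octahedral_on H"
  unfolding octahedral_on_def
proof (intro allI impI, elim conjE)
  fix F :: "('y \<Rightarrow>\<^sub>L 'x) set" and \<epsilon> :: real
  assume "finite_dimensional F" and "\<epsilon> > 0"
  then obtain B where B: "finite B" "F \<subseteq> span B"
    unfolding finite_dimensional_def by blast
  \<comment> \<open>The final estimate loses a factor (1 - \<delta>)^3, which is at least 1 -
    4\<delta>; the cap 1/4 keeps \<delta> below 1.\<close>
  define \<delta> where "\<delta> = min (\<epsilon>/4) (1/4)"
  have \<delta>: "0 < \<delta>" "\<delta> < 1" "4 * \<delta> \<le> \<epsilon>" using \<open>\<epsilon> > 0\<close> by (auto simp: \<delta>_def)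
  have sb: "schauder_basis e" and mono: "\<And>k y. norm (basis_proj e k y) \<le> norm y"
    using assms(2) by (auto simp: monotone_schauder_basis_def)
  obtain N where N: "\<And>f. f \<in> span B \<Longrightarrow>
      \<exists>z. norm z = 1 \<and> basis_proj e N z = z \<and> norm (blinfun_apply f z) \<ge> (1 - \<delta>) * norm f"
    using basis_section_almost_norming[OF assms(2) B(1) \<delta>(1,2)] by blast
  obtain J :: "(nat \<Rightarrow> real) set" and d where J: "finite J"
    and d: "\<And>z. basis_proj e N z = z \<Longrightarrow>
      \<bar>norm z - (\<Sum>j\<in>J. \<bar>\<Sum>i<N. basis_coeffs e z i * d j i\<bar>)\<bar> \<le> \<delta> * norm z"
    using basis_section_almost_ell1[OF assms(1,2) \<delta>(1), of N] by blast
  \<comment> \<open>The span of \<open>G\<close> contains \<open>f z\<close> for all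
    \<open>f\<close> in \<open>span B\<close> and all \<open>z\<close> in the range of the N-th
    projection.\<close>
  define G where "G = (\<lambda>(f, i). blinfun_apply f (e i)) ` (B \<times> {..<N})"
  have "finite G" using B(1) by (simp add: G_def)
  obtain x :: "(nat \<Rightarrow> real) \<Rightarrow> 'x" where x1: "\<And>j. j \<in> J \<Longrightarrow> norm (x j) = 1"
    and x2: "\<And>g c. g \<in> span G \<Longrightarrow>
      norm (g + (\<Sum>j\<in>J. c j *\<^sub>R x j)) \<ge> (1 - \<delta>) * (norm g + (\<Sum>j\<in>J. \<bar>c j\<bar>))"
    using octahedral_ell1_family[OF assms(3) J \<open>finite G\<close> \<delta>(1,2)] by blast
  \<comment> \<open>\<psi> gives the approximate ell_1 coordinates and \<Phi> sends them to the
    vectors \<open>x j\<close>. Only the first N coefficients of \<open>y\<close> enter, so the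
    projection is built in.\<close>
  define \<psi> where "\<psi> j y = (\<Sum>i<N. basis_coeffs e y i * d j i)" for j y
  define \<Phi> where "\<Phi> y = (\<Sum>j\<in>J. \<psi> j y *\<^sub>R x j)" for y
  have bl: "bounded_linear \<Phi>"
    unfolding \<Phi>_def \<psi>_def
    by (intro bounded_linear_sum bounded_linear_compose[OF bounded_linear_scaleR_left]
        bounded_linear_compose[OF bounded_linear_mult_left] bounded_linear_basis_coeffs assms(2))
  define T where "T = Blinfun \<Phi>"
  have T: "blinfun_apply T = \<Phi>" unfolding T_def by (rule bounded_linear_Blinfun_apply[OF bl])
  have frank: "finite_rank (c *\<^sub>R T)" for c
    unfolding finite_rank_def finite_dimensional_def
  proof (intro exI conjI)
    show "finite (x ` J)" using J by simp
    show "range (blinfun_apply (c *\<^sub>R T)) \<subseteq> span (x ` J)"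
      by (auto simp: blinfun.scaleR_left T \<Phi>_def intro!: span_scale span_sum intro: span_base)
  qed
  have normT: "norm T \<le> 1 + \<delta>"
  proof (rule norm_blinfun_bound)
    fix y
    \<comment> \<open>Passing to the projection leaves \<Phi> unchanged and makes \<open>d\<close>
      applicable; monotonicity of the basis leads back from \<open>norm z\<close> to
      \<open>norm y\<close> at no cost.\<close>
    define z where "z = basis_proj e N y"
    have "\<Phi> y = \<Phi> z"
      by (simp add: \<Phi>_def \<psi>_def z_def basis_coeffs_basis_proj[OF sb])
    also have "norm \<dots> \<le> (\<Sum>j\<in>J. norm (\<psi> j z *\<^sub>R x j))"
      unfolding \<Phi>_def by (rule norm_sum)
    also have "\<dots> = (\<Sum>j\<in>J. \<bar>\<psi> j z\<bar>)"
      using x1 by (intro sum.cong) auto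
    also have "\<dots> \<le> (1 + \<delta>) * norm z"
      using d[of z] basis_proj_basis_proj[OF sb order_refl, of N y]
      unfolding \<psi>_def z_def by (simp add: algebra_simps abs_le_iff)
    also have "\<dots> \<le> (1 + \<delta>) * norm y"
      using mono[of N y] \<delta> by (intro mult_left_mono) (auto simp: z_def)
    finally show "norm (blinfun_apply T y) \<le> (1 + \<delta>) * norm y" by (simp add: T)
  qed (use \<delta> in simp)
  have lower: "norm (blinfun_apply f z + c *\<^sub>R blinfun_apply T z) \<ge> (1 - \<delta>) * (norm (blinfun_apply f z) + \<bar>c\<bar> * (1 - \<delta>))"
    if f: "f \<in> span B" and z: "norm z = 1" "basis_proj e N z = z" for f z c
  proof -
    have "blinfun_apply f (e i) \<in> span G" if "i < N" for i
      using f
    proof (induction rule: span_induct_alt)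
      case base
      then show ?case by (simp add: span_zero)
    next
      case (step a b y)
      have "blinfun_apply b (e i) \<in> span G"
        using step(1) that by (intro span_base) (auto simp: G_def)
      then show ?case using step(2) by (simp add: blinfun.add_left blinfun.scaleR_left span_add span_scale)
    qed
    then have "blinfun_apply f (basis_proj e N z) \<in> span G"
      unfolding basis_proj_def blinfun.sum_right blinfun.scaleR_right by (intro span_sum span_scale) auto
    then have fz: "blinfun_apply f z \<in> span G" using z by simp
    have "1 - \<delta> \<le> (\<Sum>j\<in>J. \<bar>\<psi> j z\<bar>)"
      using d[OF z(2)] z(1) unfolding \<psi>_def by (simp add: abs_le_iff)
    then have "(1 - \<delta>) * (norm (blinfun_apply f z) + \<bar>c\<bar> * (1 - \<delta>))
        \<le> (1 - \<delta>) * (norm (blinfun_apply f z) + \<bar>c\<bar> * (\<Sum>j\<in>J. \<bar>\<psi> j z\<bar>))"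
      using \<delta> by (intro mult_left_mono add_left_mono) auto
    also have "\<dots> = (1 - \<delta>) * (norm (blinfun_apply f z) + (\<Sum>j\<in>J. \<bar>c * \<psi> j z\<bar>))"
      by (simp add: sum_distrib_left abs_mult)
    also have "\<dots> \<le> norm (blinfun_apply f z + (\<Sum>j\<in>J. (c * \<psi> j z) *\<^sub>R x j))"
      by (rule x2[OF fz])
    finally show ?thesis
      by (simp add: T \<Phi>_def scaleR_sum_right)
  qed
  \<comment> \<open>The estimate \<open>lower\<close> with zero operator and c = 1 gives
    \<open>T\<close> norm at least (1 - \<delta>)^2 at a unit vector.\<close>
  have "T \<noteq> 0"
  proof
    assume "T = 0"
    obtain z where "norm z = 1" "basis_proj e N z = z"
      using N[OF span_zero] by blast
    from lower[OF span_zero this, of 1] show False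
      using \<delta> \<open>T = 0\<close> by (simp add: mult_le_0_iff)
  qed
  define T' where "T' = (1 / norm T) *\<^sub>R T"
  show "\<exists>x\<in>H. norm x = 1 \<and> (\<forall>f\<in>F. \<forall>c. (1 - \<epsilon>) * (norm f + \<bar>c\<bar>) \<le> norm (f + c *\<^sub>R x))"
  proof (intro bexI[of _ T'] conjI ballI allI)
    show "T' \<in> H" unfolding T'_def by (intro assms(5) frank)
    show "norm T' = 1" using \<open>T \<noteq> 0\<close> by (simp add: T'_def)
    fix f c assume "f \<in> F"
    then have f: "f \<in> span B" using B by auto
    obtain z where z: "norm z = 1" "basis_proj e N z = z"
      and fz: "norm (blinfun_apply f z) \<ge> (1 - \<delta>) * norm f"
      using N[OF f] by blast
    have "(1 - \<delta>) * (1 + \<delta>) \<le> 1" by (simp add: algebra_simps)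
    moreover have "(1 - \<delta>) * norm T \<le> (1 - \<delta>) * (1 + \<delta>)"
      using normT \<delta> by (intro mult_left_mono) auto
    ultimately have "(1 - \<delta>) * norm T \<le> 1"
      by simp
    then have inv: "1 - \<delta> \<le> 1 / norm T"
      using \<open>T \<noteq> 0\<close> by (simp add: field_simps)
    have "1 - \<epsilon> \<le> 1 - 4 * \<delta>" using \<delta> by simp
    also have "\<dots> \<le> (1 - \<delta>) * ((1 - \<delta>) * (1 - \<delta>))"
    proof -
      \<comment> \<open>This product is the difference (1 - \<delta>)^3 - (1 - 4\<delta>).\<close>
      have "0 \<le> \<delta> * (1 + \<delta> * (3 - \<delta>))" using \<delta> by (intro mult_nonneg_nonneg add_nonneg_nonneg) auto
      then show ?thesis by (simp add: algebra_simps)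
    qed
    finally have eps: "1 - \<epsilon> \<le> (1 - \<delta>) * ((1 - \<delta>) * (1 - \<delta>))" .
    have "(1 - \<epsilon>) * (norm f + \<bar>c\<bar>) \<le> (1 - \<delta>) * ((1 - \<delta>) * (1 - \<delta>)) * (norm f + \<bar>c\<bar>)"
      using eps by (intro mult_right_mono) auto
    also have "\<dots> = (1 - \<delta>) * ((1 - \<delta>) * ((1 - \<delta>) * norm f) + \<bar>c\<bar> * (1 - \<delta>) * (1 - \<delta>))"
      by (simp add: algebra_simps)
    \<comment> \<open>The outer factor comes from octahedrality of X. For |c| the other two come
      from normalising \<open>T\<close> and from the ell_1 norm of the coordinates of
      \<open>z\<close>; for \<open>f\<close>, one comes from the almost norming point and one is
      slack.\<close>
    also have "\<dots> \<le> (1 - \<delta>) * (norm (blinfun_apply f z) + \<bar>c\<bar> * (1 / norm T) * (1 - \<delta>))"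
    proof (intro mult_left_mono add_mono mult_right_mono inv)
      have "(1 - \<delta>) * ((1 - \<delta>) * norm f) \<le> 1 * ((1 - \<delta>) * norm f)"
        using \<delta> by (intro mult_right_mono) auto
      then show "(1 - \<delta>) * ((1 - \<delta>) * norm f) \<le> norm (blinfun_apply f z)" using fz by simp
    qed (use \<delta> in auto)
    also have "\<dots> \<le> norm (blinfun_apply f z + (c / norm T) *\<^sub>R blinfun_apply T z)"
      using lower[OF f z, of "c / norm T"] by simp
    also have "\<dots> = norm (blinfun_apply (f + c *\<^sub>R T') z)"
      by (simp add: T'_def blinfun.add_left blinfun.scaleR_left)
    also have "\<dots> \<le> norm (f + c *\<^sub>R T')"
      using norm_blinfun[of "f + c *\<^sub>R T'" z] z(1) by simp
    finally show "(1 - \<epsilon>) * (norm f + \<bar>c\<bar>) \<le> norm (f + c *\<^sub>R T')" .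
  qed
qed

end
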